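(* Let $T$ be a tree all of whose branches have height $\mathrm{ht}(T)$. (a) If $\mathrm{ht}(T)<\omega$, then $T$ is reversible. (b) If $\mathrm{ht}(T)=|T|=\omega$, then the following are equivalent: (1) $T$ is reversible; (2) all nodes of $T$ are finite; (3) regarding $T$ as a downwards closed subtree (initial part) of the tree ${}^{<\omega}\omega$, the set $[T]:=\{x\in{}^{\omega}\omega:\forall n\in\omega\;\; x\upharpoonright n\in T\}$ is a compact subset of the Baire space $\omega^\omega$.
   Context: A tree is a strict partial order $\langle T,<\rangle$ such that for each $t\in T$ the set $(\cdot,t):=\{s\in T:s<t\}$ is well-ordered or empty. The height of $t$ is the order type of $(\cdot,t)$; $L_\alpha$ is the set of elements of height $\alpha$; the height $\mathrm{ht}(T)$ of $T$ is the least ordinal $\alpha$ with $L_\alpha=\emptyset$. A branch is a maximal chain of $T$, and its height is its order type. The nodes of $T$ are the equivalence classes of the relation $s\sim t \Leftrightarrow (\cdot,s)=(\cdot,t)$. A tree $T$ is reversible iff every condensation of $T$, i.e. every bijection $f:T\to T$ such that $x<y$ implies $f(x)<f(y)$, is an automorphism of $T$. ${}^{<\omega}\omega$ is the tree of all finite sequences of natural numbers ordered by proper extension; a subset $S$ of it is downwards closed if it contains all initial segments of its elements. The Baire space $\omega^\omega$ is the set ${}^\omega\omega$ of all infinite sequences of natural numbers with the product topology of discrete spaces $\omega$. *)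

theory Defs
  imports "HOL-Analysis.Analysis" "HOL-Library.Sublist"
begin

unbundle cardinal_syntax

text \<open>
  A tree is a carrier set \<open>T\<close> with a strict order \<open>lt\<close>; only the values of \<open>lt\<close> on \<open>T\<close> matter.
  Ordinals are represented by (reflexive) well-orders, compared with \<open>=o\<close>, \<open><o\<close> and \<open>\<le>o\<close>;
  \<open>\<omega>\<close> is \<^const>\<open>natLeq\<close>.
\<close>

definition preds :: "'a set \<Rightarrow> ('a \<Rightarrow> 'a \<Rightarrow> bool) \<Rightarrow> 'a \<Rightarrow> 'a set" where
  "preds T lt t = {s \<in> T. lt s t}"

definition order_on :: "('a \<Rightarrow> 'a \<Rightarrow> bool) \<Rightarrow> 'a set \<Rightarrow> 'a rel" where
  "order_on lt A = {(x, y). x \<in> A \<and> y \<in> A \<and> (x = y \<or> lt x y)}"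

definition is_tree :: "'a set \<Rightarrow> ('a \<Rightarrow> 'a \<Rightarrow> bool) \<Rightarrow> bool" where
  "is_tree T lt \<longleftrightarrow>
     irreflp_on T lt \<and> transp_on T lt \<and> (\<forall>t\<in>T. Well_order (order_on lt (preds T lt t)))"

definition level :: "'a set \<Rightarrow> ('a \<Rightarrow> 'a \<Rightarrow> bool) \<Rightarrow> 'b rel \<Rightarrow> 'a set" where
  "level T lt r = {t \<in> T. order_on lt (preds T lt t) =o r}"

text \<open>
  Well-orders of subsets of the element type suffice for the least ordinal with empty level: all
  smaller ordinals are heights of elements, so picking one element of each height gives a
  set of elements which, ordered by height, has that order type.
  It is determined only up to \<open>=o\<close>.
\<close>
definition tree_height :: "'a set \<Rightarrow> ('a \<Rightarrow> 'a \<Rightarrow> bool) \<Rightarrow> 'a rel" where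
  "tree_height T lt =
     (SOME h. Well_order h \<and> level T lt h = {} \<and>
        (\<forall>r :: 'a rel. Well_order r \<and> level T lt r = {} \<longrightarrow> h \<le>o r))"

abbreviation branch :: "'a set \<Rightarrow> ('a \<Rightarrow> 'a \<Rightarrow> bool) \<Rightarrow> 'a set \<Rightarrow> bool" where
  "branch T lt B \<equiv> pred_on.maxchain T lt B"

definition nodes :: "'a set \<Rightarrow> ('a \<Rightarrow> 'a \<Rightarrow> bool) \<Rightarrow> 'a set set" where
  "nodes T lt = T // {(s, t). s \<in> T \<and> t \<in> T \<and> preds T lt s = preds T lt t}"

definition order_iso ::
  "'a set \<Rightarrow> ('a \<Rightarrow> 'a \<Rightarrow> bool) \<Rightarrow> 'b set \<Rightarrow> ('b \<Rightarrow> 'b \<Rightarrow> bool) \<Rightarrow> ('a \<Rightarrow> 'b) \<Rightarrow> bool" where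
  "order_iso T lt S lt' f \<longleftrightarrow>
     bij_betw f T S \<and> (\<forall>x\<in>T. \<forall>y\<in>T. lt x y \<longleftrightarrow> lt' (f x) (f y))"

definition condensation :: "'a set \<Rightarrow> ('a \<Rightarrow> 'a \<Rightarrow> bool) \<Rightarrow> ('a \<Rightarrow> 'a) \<Rightarrow> bool" where
  "condensation T lt f \<longleftrightarrow> bij_betw f T T \<and> monotone_on T lt lt f"

definition reversible :: "'a set \<Rightarrow> ('a \<Rightarrow> 'a \<Rightarrow> bool) \<Rightarrow> bool" where
  "reversible T lt \<longleftrightarrow> (\<forall>f. condensation T lt f \<longrightarrow> order_iso T lt T lt f)"

definition downwards_closed :: "nat list set \<Rightarrow> bool" where
  "downwards_closed S \<longleftrightarrow> (\<forall>s\<in>S. \<forall>u. prefix u s \<longrightarrow> u \<in> S)"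

text \<open>
  A nonempty downwards closed set of finite sequences contains the empty sequence and hence has a
  least element. So a tree with a least element is represented by a downwards closed set isomorphic
  to it, while one with several minimal elements becomes such a set only after a root, the empty
  sequence, is added below it.
\<close>
definition represents :: "'a set \<Rightarrow> ('a \<Rightarrow> 'a \<Rightarrow> bool) \<Rightarrow> nat list set \<Rightarrow> bool" where
  "represents T lt S \<longleftrightarrow>
     downwards_closed S \<and>
     (if \<exists>r\<in>T. \<forall>t\<in>T. t = r \<or> lt r t
      then \<exists>f. order_iso T lt S strict_prefix f
      else [] \<in> S \<and> (\<exists>f. order_iso T lt (S - {[]}) strict_prefix f))"

definition infinite_branches :: "nat list set \<Rightarrow> (nat \<Rightarrow> nat) set" where
  "infinite_branches S = {x. \<forall>n. map x [0..<n] \<in> S}"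

definition baire_space :: "(nat \<Rightarrow> nat) topology" where
  "baire_space = product_topology (\<lambda>_. discrete_topology UNIV) UNIV"

end

theory Submission
  imports Defs "HOL-Library.Countable_Set_Type"
begin

text \<open>
  Let \<open>h\<close> be the common order type of the branches. When \<open>h \<le> \<omega>\<close>, every element has finitely many
  predecessors, because they form a proper initial segment of a branch, and their number is its
  height. A condensation never lowers heights, and it is an automorphism as soon as it preserves
  them (\<open>level_preserving_condensation_is_automorphism\<close>).

  If \<open>h\<close> is finite, a condensation carries a branch to a chain of the same finite size, hence to a
  branch, and cannot raise heights (\<open>reversible_if_branches_equally_finite\<close>). If \<open>h = \<omega>\<close> and all
  nodes are finite, every level is finite; the finite set of elements of height at most \<open>n\<close>
  contains its own preimage under a condensation, so it equals this preimage, and heights are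
  preserved again (\<open>reversible_if_levels_finite\<close>).

  Conversely let \<open>N\<close> be an infinite node of a countable tree whose branches have type \<open>\<omega>\<close>. The
  part of the tree on and above \<open>N\<close> is a countable forest with infinitely many minimal elements in
  which everything has infinitely many elements above it. A back-and-forth construction gives a
  condensation of this forest that raises a minimal element, and the identity extends it to the
  whole tree (\<open>not_reversible_if_infinite_node\<close>).

  For the topological condition, nodes are finite iff every sequence in the representing tree \<open>S\<close>
  of finite sequences has finitely many immediate successors. As branches are infinite, every
  sequence in \<open>S\<close> extends to a point of \<open>[S]\<close>, and for such \<open>S\<close> finite branching is equivalent to
  compactness (\<open>compactin_infinite_branches_iff\<close>).
\<close>

section \<open>Branches and their order types\<close>

lemma chain_extends_to_branch:
  assumes C: "pred_on.chain T lt C"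
  shows "\<exists>B. branch T lt B \<and> C \<subseteq> B"
proof -
  \<comment> \<open>A maximal chain among the elements comparable with all of \<open>C\<close> contains \<open>C\<close>.\<close>
  define A where "A = {s \<in> T. \<forall>c\<in>C. s = c \<or> lt s c \<or> lt c s}"
  obtain B where B: "pred_on.maxchain A lt B" using pred_on.Hausdorff by blast
  then have chB: "pred_on.chain A lt B" by (simp add: pred_on.maxchain_def)
  have "pred_on.chain A lt (B \<union> C)"
  proof (rule pred_on.chainI)
    have "C \<subseteq> A" using C unfolding pred_on.chain_def A_def by blast
    then show "B \<union> C \<subseteq> A" using chB by (simp add: pred_on.chain_def)
    then show "lt\<^sup>=\<^sup>= x y \<or> lt\<^sup>=\<^sup>= y x" if "x \<in> B \<union> C" "y \<in> B \<union> C" for x y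
      using that chB unfolding pred_on.chain_def A_def by auto
  qed
  then have CB: "C \<subseteq> B" using B unfolding pred_on.maxchain_def by blast
  have "pred_on.chain A lt D" if "pred_on.chain T lt D" "B \<subset> D" for D
  proof -
    have "s = c \<or> lt s c \<or> lt c s" if "s \<in> D" "c \<in> C" for s c
      using \<open>pred_on.chain T lt D\<close> \<open>B \<subset> D\<close> CB that unfolding pred_on.chain_def by blast
    then show ?thesis using that(1) by (auto simp: pred_on.chain_def A_def)
  qed
  moreover have "pred_on.chain T lt B"
    using chB by (auto simp: pred_on.chain_def A_def)
  ultimately have "branch T lt B" using B unfolding pred_on.maxchain_def by blast
  then show ?thesis using CB by blast
qed

lemma branch_through:
  assumes "t \<in> T"
  obtains B where "branch T lt B" "t \<in> B"
  using chain_extends_to_branch[of T lt "{t}"] assms by (auto simp: pred_on.chain_def)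

lemma branch_subset: "branch T lt B \<Longrightarrow> B \<subseteq> T"
  by (simp add: pred_on.maxchain_def pred_on.chain_def)

lemma Field_order_on [simp]: "Field (order_on lt B) = B"
  by (auto simp: order_on_def Field_def)

lemma finite_if_order_type_finite:
  fixes h :: "'b rel"
  assumes "order_on lt B =o h" "h <o natLeq"
  shows "finite B"
proof -
  have less: "order_on lt B <o natLeq" using assms by (rule ordIso_ordLess_trans)
  then have "Well_order (order_on lt B)" by (simp add: ordLess_def)
  then have "|B| \<le>o order_on lt B" using card_of_least by (metis Field_order_on)
  then show ?thesis
    using less finite_iff_ordLess_natLeq ordLeq_ordLess_trans by blast
qed

lemma card_eq_if_order_types_eq:
  fixes h :: "'b rel"
  assumes "order_on lt B =o h" "order_on lt C =o h"
  shows "card B = card C"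
proof -
  have "order_on lt B =o order_on lt C"
    using assms ordIso_symmetric ordIso_transitive by blast
  then obtain f where "bij_betw f B C" by (auto simp: ordIso_def iso_iff2)
  then show ?thesis by (rule bij_betw_same_card)
qed

lemma order_type_omega:
  assumes "order_on lt B =o natLeq"
  shows "infinite B" and "b \<in> B \<Longrightarrow> finite {x \<in> B. lt x b}"
proof -
  obtain f where "iso (order_on lt B) natLeq f" using assms by (auto simp: ordIso_def)
  then have bij: "bij_betw f B UNIV"
    and f: "\<And>x y. x \<in> B \<Longrightarrow> y \<in> B \<Longrightarrow> (x, y) \<in> order_on lt B \<longleftrightarrow> f x \<le> f y"
    by (simp_all add: iso_iff2 Field_natLeq) (simp add: natLeq_def)
  show "infinite B" using bij bij_betw_finite infinite_UNIV_nat by blast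
  assume b: "b \<in> B"
  have "f ` {x \<in> B. lt x b} \<subseteq> {..f b}"
    using f b by (auto simp: order_on_def)
  moreover have "inj_on f {x \<in> B. lt x b}"
    using bij by (auto simp: bij_betw_def inj_on_def)
  ultimately show "finite {x \<in> B. lt x b}"
    using inj_on_finite by blast
qed

section \<open>Trees with finite predecessor sets\<close>

locale linear_pred_tree =
  fixes T :: "'a set" and lt :: "'a \<Rightarrow> 'a \<Rightarrow> bool"
  assumes irrefl: "\<And>x. x \<in> T \<Longrightarrow> \<not> lt x x"
    and trans: "\<And>x y z. x \<in> T \<Longrightarrow> y \<in> T \<Longrightarrow> z \<in> T \<Longrightarrow> lt x y \<Longrightarrow> lt y z \<Longrightarrow> lt x z"
    and linear_preds:
      "\<And>t x y. t \<in> T \<Longrightarrow> x \<in> T \<Longrightarrow> y \<in> T \<Longrightarrow> lt x t \<Longrightarrow> lt y t \<Longrightarrow> x = y \<or> lt x y \<or> lt y x"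
begin

lemma preds_subset_branch:
  assumes B: "branch T lt B" and t: "t \<in> B"
  shows "preds T lt t \<subseteq> B"
proof
  fix s assume "s \<in> preds T lt t"
  then have s: "s \<in> T" "lt s t" by (auto simp: preds_def)
  have BT: "B \<subseteq> T" using B by (rule branch_subset)
  have ch: "pred_on.chain T lt B" using B by (simp add: pred_on.maxchain_def)
  have "s = b \<or> lt s b \<or> lt b s" if b: "b \<in> B" for b
  proof -
    have "b = t \<or> lt b t \<or> lt t b" using ch b t by (auto simp: pred_on.chain_def)
    then show ?thesis using linear_preds[of t s b] trans[of s t b] s b t BT by blast
  qed
  then have "pred_on.chain T lt (insert s B)"
    using ch s by (auto simp: pred_on.chain_def)
  then show "s \<in> B" using B unfolding pred_on.maxchain_def by blast
qed

end

lemma is_tree_linear_preds: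
  assumes "is_tree T lt"
  shows "linear_pred_tree T lt"
proof
  show "\<not> lt x x" if "x \<in> T" for x
    using assms that by (auto simp: is_tree_def irreflp_on_def)
  show "lt x z" if "x \<in> T" "y \<in> T" "z \<in> T" "lt x y" "lt y z" for x y z
    using assms that unfolding is_tree_def by (meson transp_onD)
  show "x = y \<or> lt x y \<or> lt y x" if "t \<in> T" "x \<in> T" "y \<in> T" "lt x t" "lt y t" for t x y
  proof -
    have "Well_order (order_on lt (preds T lt t))" using assms that by (simp add: is_tree_def)
    then have "total_on (preds T lt t) (order_on lt (preds T lt t))"
      by (simp add: well_order_on_def linear_order_on_def)
    then show ?thesis using that by (auto simp: total_on_def order_on_def preds_def)
  qed
qed

locale finite_pred_tree = linear_pred_tree +
  assumes finite_preds: "\<And>t. t \<in> T \<Longrightarrow> finite (preds T lt t)"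
begin

definition height :: "'a \<Rightarrow> nat" where
  "height t = card (preds T lt t)"

lemma height_less:
  assumes "x \<in> T" "y \<in> T" "lt x y"
  shows "height x < height y"
proof -
  have "preds T lt x \<subset> preds T lt y"
    using assms irrefl trans unfolding preds_def by blast
  then show ?thesis
    unfolding height_def using finite_preds[OF assms(2)] by (rule psubset_card_mono[rotated])
qed

lemma height_image_preds:
  assumes "t \<in> T"
  shows "height ` preds T lt t = {..<height t}"
proof -
  have inj: "inj_on height (preds T lt t)"
    using assms linear_preds height_less unfolding inj_on_def preds_def
    by (metis (mono_tags, lifting) mem_Collect_eq nat_neq_iff)
  have "height ` preds T lt t \<subseteq> {..<height t}"
    using assms height_less unfolding preds_def by auto
  moreover have "card (height ` preds T lt t) = card {..<height t}"
    using card_image[OF inj] by (simp add: height_def)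
  ultimately show ?thesis
    by (simp add: card_subset_eq)
qed

lemma ancestor_exists:
  assumes "t \<in> T" "k \<le> height t"
  shows "\<exists>s\<in>T. (s = t \<or> lt s t) \<and> height s = k"
proof (cases "k = height t")
  case False
  then have "k \<in> height ` preds T lt t"
    using height_image_preds assms by simp
  then show ?thesis unfolding preds_def by auto
qed (use assms in auto)

lemma ancestor_unique:
  assumes "t \<in> T" "a \<in> T" "b \<in> T" "a = t \<or> lt a t" "b = t \<or> lt b t" "height a = height b"
  shows "a = b"
  using assms height_less linear_preds by (metis nat_neq_iff)

lemma parent_exists:
  assumes "t \<in> T" "preds T lt t \<noteq> {}"
  obtains p where "p \<in> T" "lt p t" "preds T lt t = insert p (preds T lt p)"
    "height t = Suc (height p)"
proof -
  have "height t \<noteq> 0"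
    using assms finite_preds by (simp add: height_def)
  then obtain k where k: "height t = Suc k" by (cases "height t") auto
  then obtain p where p: "p \<in> T" "p = t \<or> lt p t" "height p = k"
    using ancestor_exists[of t k] assms by auto
  then have pt: "lt p t" using k by auto
  have "preds T lt t = insert p (preds T lt p)"
  proof (intro equalityI subsetI)
    fix x assume "x \<in> preds T lt t"
    then have x: "x \<in> T" "lt x t" by (auto simp: preds_def)
    then have "\<not> lt p x"
      using height_less[of x t] height_less[of p x] p k assms by auto
    then show "x \<in> insert p (preds T lt p)"
      using linear_preds[of t x p] x p pt assms by (auto simp: preds_def)
  next
    fix x assume "x \<in> insert p (preds T lt p)"
    then have "x \<in> T" "x = p \<or> lt x p" using p by (auto simp: preds_def)
    then show "x \<in> preds T lt t"
      using p pt trans[of x p t] assms by (auto simp: preds_def)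
  qed
  then show thesis using that p pt k by blast
qed

section \<open>Condensations and levels\<close>

lemma condensation_height_le:
  assumes "condensation T lt f" "x \<in> T"
  shows "height x \<le> height (f x)"
proof -
  have bij: "bij_betw f T T" and mono: "\<And>x y. x \<in> T \<Longrightarrow> y \<in> T \<Longrightarrow> lt x y \<Longrightarrow> lt (f x) (f y)"
    using assms by (auto simp: condensation_def monotone_on_def)
  have fx: "f x \<in> T" using bij assms by (auto simp: bij_betw_def)
  have "f ` preds T lt x \<subseteq> preds T lt (f x)"
    using mono bij assms by (auto simp: preds_def bij_betw_def)
  moreover have "inj_on f (preds T lt x)"
    using bij by (auto simp: preds_def bij_betw_def inj_on_def)
  ultimately show ?thesis
    unfolding height_def using finite_preds[OF fx] by (metis card_inj_on_le)
qed

text \<open>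
  If \<open>f x < f y\<close>, the ancestor \<open>z\<close> of \<open>y\<close> on the level of \<open>x\<close> satisfies \<open>f z < f y\<close>, and \<open>f z\<close>
  lies on the level of \<open>f x\<close>; below \<open>f y\<close> there is only one element of that level, so \<open>z = x\<close>.
\<close>
lemma level_preserving_condensation_is_automorphism:
  assumes cond: "condensation T lt f" and le: "\<And>x. x \<in> T \<Longrightarrow> height (f x) \<le> height x"
  shows "order_iso T lt T lt f"
proof -
  have bij: "bij_betw f T T" and mono: "\<And>x y. x \<in> T \<Longrightarrow> y \<in> T \<Longrightarrow> lt x y \<Longrightarrow> lt (f x) (f y)"
    using cond by (auto simp: condensation_def monotone_on_def)
  have fT: "\<And>x. x \<in> T \<Longrightarrow> f x \<in> T" using bij by (auto simp: bij_betw_def)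
  have eq: "\<And>x. x \<in> T \<Longrightarrow> height (f x) = height x"
    using le condensation_height_le[OF cond] by (simp add: le_antisym)
  have "lt x y" if xy: "x \<in> T" "y \<in> T" "lt (f x) (f y)" for x y
  proof -
    have hxy: "height x < height y" using height_less[of "f x" "f y"] xy fT eq by simp
    then obtain z where z: "z \<in> T" "lt z y" "height z = height x"
      using ancestor_exists[of y "height x"] xy by auto
    then have "f z = f x"
      using ancestor_unique[of "f y" "f z" "f x"] mono xy fT eq by auto
    then show ?thesis using z xy bij by (auto simp: bij_betw_def inj_on_def)
  qed
  then show ?thesis using bij mono unfolding order_iso_def by blast
qed

text \<open>
  A condensation maps a branch injectively to a chain, which for lack of room is again a branch;
  hence everything below \<open>f x\<close> is the image of something below \<open>x\<close>.
\<close>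
lemma reversible_if_branches_equally_finite:
  assumes fin: "\<And>B. branch T lt B \<Longrightarrow> finite B" and card: "\<And>B. branch T lt B \<Longrightarrow> card B = n"
  shows "reversible T lt"
  unfolding reversible_def
proof (intro allI impI)
  fix f assume cond: "condensation T lt f"
  then have bij: "bij_betw f T T" and mono: "\<And>x y. x \<in> T \<Longrightarrow> y \<in> T \<Longrightarrow> lt x y \<Longrightarrow> lt (f x) (f y)"
    by (auto simp: condensation_def monotone_on_def)
  have fT: "\<And>x. x \<in> T \<Longrightarrow> f x \<in> T" using bij by (auto simp: bij_betw_def)
  show "order_iso T lt T lt f"
  proof (rule level_preserving_condensation_is_automorphism[OF cond])
    fix x assume x: "x \<in> T"
    obtain B where B: "branch T lt B" "x \<in> B" using x by (rule branch_through)
    have BT: "B \<subseteq> T" using B by (simp add: branch_subset)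
    have comparable: "a = b \<or> lt a b \<or> lt b a" if "a \<in> B" "b \<in> B" for a b
      using B that by (auto simp: pred_on.maxchain_def pred_on.chain_def)
    have "lt (f a) (f b) \<or> f a = f b \<or> lt (f b) (f a)" if "a \<in> B" "b \<in> B" for a b
      using comparable[OF that] mono[of a b] mono[of b a] BT that by auto
    then have "pred_on.chain T lt (f ` B)"
      using fT BT unfolding pred_on.chain_def by blast
    then obtain B' where B': "branch T lt B'" "f ` B \<subseteq> B'"
      using chain_extends_to_branch by blast
    have "inj_on f B" using bij BT by (auto simp: bij_betw_def intro: inj_on_subset)
    then have "card (f ` B) = card B'" using card B B' by (simp add: card_image)
    then have B'_eq: "f ` B = B'" using B' fin by (simp add: card_subset_eq)
    have "preds T lt (f x) \<subseteq> f ` preds T lt x"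
    proof
      fix s assume s: "s \<in> preds T lt (f x)"
      then have "s \<in> f ` B" using preds_subset_branch[OF B'(1), of "f x"] B'_eq B by blast
      then obtain b where b: "b \<in> B" "s = f b" by blast
      have less: "lt (f b) (f x)" using s b by (simp add: preds_def)
      have bT: "b \<in> T" using b BT by blast
      have "b \<noteq> x" using less irrefl[OF fT[OF x]] by auto
      moreover have "\<not> lt x b"
        using less mono[of x b] trans[of "f x" "f b" "f x"] irrefl[of "f x"] fT x bT by blast
      ultimately have "lt b x" using comparable[OF b(1) B(2)] by blast
      then show "s \<in> f ` preds T lt x" using b bT by (auto simp: preds_def)
    qed
    then show "height (f x) \<le> height x"
      unfolding height_def using finite_preds[OF x] by (rule surj_card_le[rotated])
  qed
qed

lemma reversible_if_levels_finite:
  assumes fin: "\<And>n. finite {t \<in> T. height t = n}"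
  shows "reversible T lt"
  unfolding reversible_def
proof (intro allI impI)
  fix f assume cond: "condensation T lt f"
  then have bij: "bij_betw f T T" by (simp add: condensation_def)
  show "order_iso T lt T lt f"
  proof (rule level_preserving_condensation_is_automorphism[OF cond])
    fix x assume x: "x \<in> T"
    define A where "A = {t \<in> T. height t \<le> height x}"
    define B where "B = {t \<in> T. f t \<in> A}"
    have "A = (\<Union>n\<le>height x. {t \<in> T. height t = n})" by (auto simp: A_def)
    then have finA: "finite A" using fin by simp
    have BA: "B \<subseteq> A"
      using condensation_height_le[OF cond] by (force simp: A_def B_def)
    have "A \<subseteq> f ` B"
    proof
      fix a assume a: "a \<in> A"
      then have "a \<in> f ` T" using bij by (auto simp: bij_betw_def A_def)
      then show "a \<in> f ` B" using a by (auto simp: B_def)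
    qed
    then have "card A \<le> card B"
      using finA BA by (meson finite_subset surj_card_le)
    then have "B = A" using BA finA by (simp add: card_seteq)
    then show "height (f x) \<le> height x" using x by (auto simp: A_def B_def)
  qed
qed

text \<open>
  A node is a nonempty set of elements sharing a set \<open>P\<close> of predecessors, so quantifying over \<open>P\<close>
  only adds empty sets.
\<close>
lemma finite_nodes_iff:
  "(\<forall>N\<in>nodes T lt. finite N) \<longleftrightarrow> (\<forall>P. finite {t \<in> T. preds T lt t = P})"
proof
  assume fin: "\<forall>N\<in>nodes T lt. finite N"
  show "\<forall>P. finite {t \<in> T. preds T lt t = P}"
  proof
    fix P
    show "finite {t \<in> T. preds T lt t = P}"
    proof (cases "{t \<in> T. preds T lt t = P} = {}")
      case False
      then obtain t where t: "t \<in> T" "preds T lt t = P" by auto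
      then have "{t \<in> T. preds T lt t = P} \<in> nodes T lt"
        unfolding nodes_def quotient_def by auto
      then show ?thesis using fin by blast
    next
      case True
      then show ?thesis by (metis finite.emptyI)
    qed
  qed
next
  assume fin: "\<forall>P. finite {t \<in> T. preds T lt t = P}"
  show "\<forall>N\<in>nodes T lt. finite N"
  proof
    fix N assume "N \<in> nodes T lt"
    then obtain s where "N = {t \<in> T. preds T lt t = preds T lt s}"
      unfolding nodes_def quotient_def by auto
    then show "finite N" using fin by simp
  qed
qed

lemma finite_levels_if_finite_nodes:
  assumes "\<And>P. finite {t \<in> T. preds T lt t = P}"
  shows "finite {t \<in> T. height t = n}"
proof (induction n)
  case 0
  have "{t \<in> T. height t = 0} = {t \<in> T. preds T lt t = {}}"
    using finite_preds by (auto simp: height_def)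
  then show ?case using assms by simp
next
  case (Suc n)
  have "{t \<in> T. height t = Suc n} \<subseteq>
    (\<Union>p\<in>{t \<in> T. height t = n}. {t \<in> T. preds T lt t = insert p (preds T lt p)})"
  proof
    fix t assume t: "t \<in> {t \<in> T. height t = Suc n}"
    then have "preds T lt t \<noteq> {}" by (auto simp: height_def)
    then obtain p where "p \<in> T" "preds T lt t = insert p (preds T lt p)" "height t = Suc (height p)"
      using parent_exists[of t] t by blast
    then show "t \<in> (\<Union>p\<in>{t \<in> T. height t = n}. {t \<in> T. preds T lt t = insert p (preds T lt p)})"
      using t by auto
  qed
  then show ?case
    by (rule finite_subset) (use Suc assms in blast)
qed

section \<open>Back and forth\<close>

text \<open>
  Finite stages of the construction, given by graphs. That the domain is downwards closed
  guarantees that an element entering it later is never below an element already there, so that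
  monotonicity only asks a new value to lie above the values of the predecessors.
\<close>
definition stage :: "('a \<times> 'a) set \<Rightarrow> bool" where
  "stage G \<longleftrightarrow> finite G \<and> G \<subseteq> T \<times> T \<and>
    (\<forall>x y x' y'. (x, y) \<in> G \<longrightarrow> (x', y') \<in> G \<longrightarrow> (x = x' \<longleftrightarrow> y = y') \<and> (lt x x' \<longrightarrow> lt y y')) \<and>
    (\<forall>x\<in>Domain G. preds T lt x \<subseteq> Domain G)"

lemma stage_insert:
  assumes G: "stage G" and "x \<in> T" "y \<in> T" "x \<notin> Domain G" "y \<notin> Range G"
    and dom: "preds T lt x \<subseteq> Domain G"
    and above: "\<And>x' y'. (x', y') \<in> G \<Longrightarrow> lt x' x \<Longrightarrow> lt y' y"
  shows "stage (insert (x, y) G)"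
proof -
  have notabove: "\<not> lt x x'" if "(x', y') \<in> G" for x' y'
  proof
    assume "lt x x'"
    then have "x \<in> preds T lt x'" using assms by (simp add: preds_def)
    then show False using G that assms by (auto simp: stage_def)
  qed
  have "\<not> lt x x" using irrefl assms by blast
  then show ?thesis
    using assms notabove unfolding stage_def
    by (auto 0 3 simp: Domain_iff Range_iff)
qed

lemma stage_extend_range:
  assumes G: "stage G" and y: "y \<in> T" and inf: "infinite {x \<in> T. preds T lt x = {}}"
  shows "\<exists>G'. stage G' \<and> G \<subseteq> G' \<and> y \<in> Range G'"
proof (cases "y \<in> Range G")
  case False
  have "finite (Domain G)" using G by (simp add: stage_def finite_Domain)
  then have "infinite ({x \<in> T. preds T lt x = {}} - Domain G)" using inf by simp
  then obtain x where x: "x \<in> T" "preds T lt x = {}" "x \<notin> Domain G"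
    using infinite_imp_nonempty by blast
  have "stage (insert (x, y) G)"
    using x False y G by (intro stage_insert) (auto simp: stage_def preds_def)
  then show ?thesis by blast
qed (use G in blast)

lemma stage_extend_domain:
  assumes up: "\<And>y. y \<in> T \<Longrightarrow> infinite {z \<in> T. lt y z}"
  shows "stage G \<Longrightarrow> x \<in> T \<Longrightarrow> \<exists>G'. stage G' \<and> G \<subseteq> G' \<and> x \<in> Domain G'"
proof (induction "height x" arbitrary: x rule: less_induct)
  case less
  note G = \<open>stage G\<close> and x = \<open>x \<in> T\<close>
  show ?case
  proof (cases "preds T lt x = {}")
    case True
    show ?thesis
    proof (cases "x \<in> Domain G")
      case False
      have "infinite T" using up[OF x] by (rule contrapos_nn) simp
      moreover have "finite (Range G)" using G by (simp add: stage_def finite_Range)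
      ultimately have "infinite (T - Range G)" by simp
      then obtain y where y: "y \<in> T" "y \<notin> Range G"
        using infinite_imp_nonempty by blast
      have "stage (insert (x, y) G)"
        using x False True y G by (intro stage_insert) (auto simp: stage_def preds_def)
      then show ?thesis by blast
    qed (use G in blast)
  next
    case False
    then obtain p where p: "p \<in> T" "lt p x" "preds T lt x = insert p (preds T lt p)"
      "height x = Suc (height p)"
      using parent_exists[OF x] by blast
    then obtain H where H: "stage H" "G \<subseteq> H" "p \<in> Domain H"
      using less.hyps[of p] G by auto
    show ?thesis
    proof (cases "x \<in> Domain H")
      case False
      obtain q where q: "(p, q) \<in> H" using H by blast
      then have qT: "q \<in> T" using H by (auto simp: stage_def)
      have "finite (Range H)" using H by (simp add: stage_def finite_Range)
      then have "infinite ({z \<in> T. lt q z} - Range H)" using up[OF qT] by simp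
      then obtain y where y: "y \<in> T" "lt q y" "y \<notin> Range H"
        using infinite_imp_nonempty by blast
      have "stage (insert (x, y) H)"
      proof (rule stage_insert)
        show "preds T lt x \<subseteq> Domain H" using p H by (auto simp: stage_def)
        fix x' y' assume xy': "(x', y') \<in> H" "lt x' x"
        then have T': "x' \<in> T" "y' \<in> T" using H by (auto simp: stage_def)
        then have "x' = p \<or> lt x' p" using xy' p by (auto simp: preds_def)
        then have "y' = q \<or> lt y' q" using xy' q H unfolding stage_def by blast
        then show "lt y' y" using trans T' qT y by blast
      qed (use H x y False in auto)
      then show ?thesis using H by blast
    qed (use H in blast)
  qed
qed

text \<open>
  Both kinds of requests can be met at every stage: a prescribed value is taken by a fresh minimal
  element, on which no constraint is imposed yet, and a prescribed argument, once its parent has a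
  value, finds an unused one among the infinitely many elements above that value.
\<close>
lemma condensation_with_prescribed_value:
  assumes count: "countable T" and inf: "infinite {x \<in> T. preds T lt x = {}}"
    and up: "\<And>y. y \<in> T \<Longrightarrow> infinite {z \<in> T. lt y z}"
    and x0: "x0 \<in> T" "preds T lt x0 = {}" and y0: "y0 \<in> T"
  shows "\<exists>f. condensation T lt f \<and> f x0 = y0"
proof -
  define u where "u = from_nat_into T"
  have uT: "u n \<in> T" for n using x0 unfolding u_def by (intro from_nat_into) auto
  have "\<exists>G. \<forall>n. (stage (G n) \<and> (x0, y0) \<in> G n) \<and>
    (G n \<subseteq> G (Suc n) \<and> u n \<in> Domain (G (Suc n)) \<and> u n \<in> Range (G (Suc n)))"
  proof (rule dependent_nat_choice)
    have "stage {(x0, y0)}"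
      using x0 y0 irrefl by (auto simp: stage_def)
    then show "\<exists>G. stage G \<and> (x0, y0) \<in> G" by blast
  next
    fix G n assume G: "stage G \<and> (x0, y0) \<in> G"
    then obtain H where H: "stage H" "G \<subseteq> H" "u n \<in> Domain H"
      using stage_extend_domain[OF up] uT by meson
    then obtain K where K: "stage K" "H \<subseteq> K" "u n \<in> Range K"
      using stage_extend_range[OF _ _ inf] uT by meson
    then show "\<exists>K. (stage K \<and> (x0, y0) \<in> K) \<and> (G \<subseteq> K \<and> u n \<in> Domain K \<and> u n \<in> Range K)"
      using G H K by (intro exI[of _ K] conjI) blast+
  qed
  then obtain G where G: "\<And>n. stage (G n)" "\<And>n. (x0, y0) \<in> G n" "\<And>n. G n \<subseteq> G (Suc n)"
    "\<And>n. u n \<in> Domain (G (Suc n))" "\<And>n. u n \<in> Range (G (Suc n))" by blast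
  have mono: "G m \<subseteq> G n" if "m \<le> n" for m n using G(3) that by (rule lift_Suc_mono_le)
  define R where "R = (\<Union>n. G n)"
  have R: "(x = x' \<longleftrightarrow> y = y') \<and> (lt x x' \<longrightarrow> lt y y')" if xy: "(x, y) \<in> R" "(x', y') \<in> R" for x y x' y'
  proof -
    obtain m n where mn: "(x, y) \<in> G m" "(x', y') \<in> G n" using xy by (auto simp: R_def)
    have "(x, y) \<in> G (max m n)" "(x', y') \<in> G (max m n)"
      using mn mono[of m "max m n"] mono[of n "max m n"] by auto
    then show ?thesis using G(1)[of "max m n"] unfolding stage_def by blast
  qed
  have RT: "R \<subseteq> T \<times> T" using G(1) unfolding R_def stage_def by blast
  have surj_u: "\<exists>n. t = u n" if "t \<in> T" for t
    using from_nat_into_surj[OF count that] unfolding u_def by metis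
  have dom: "\<exists>y. (t, y) \<in> R" and ran: "\<exists>x. (x, t) \<in> R" if "t \<in> T" for t
    using surj_u[OF that] G(4,5) by (auto simp: R_def Domain_iff Range_iff) blast+
  define f where "f x = (SOME y. (x, y) \<in> R)" for x
  have f: "(x, f x) \<in> R" if "x \<in> T" for x
    using dom[OF that] unfolding f_def by (rule someI_ex)
  have "bij_betw f T T"
  proof (rule bij_betw_imageI)
    show "inj_on f T" using f R unfolding inj_on_def by metis
    show "f ` T = T"
    proof
      show "f ` T \<subseteq> T" using f RT by blast
      show "T \<subseteq> f ` T"
      proof
        fix y assume "y \<in> T"
        then obtain x where xy: "(x, y) \<in> R" using ran by blast
        then have "x \<in> T" using RT by blast
        moreover have "f x = y" using f[OF \<open>x \<in> T\<close>] xy R by blast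
        ultimately show "y \<in> f ` T" by blast
      qed
    qed
  qed
  moreover have "monotone_on T lt lt f"
    using f R by (intro monotone_onI) blast
  moreover have "f x0 = y0"
    using f[OF x0(1)] G(2)[of 0] R by (metis R_def UN_I UNIV_I)
  ultimately show ?thesis by (auto simp: condensation_def)
qed

lemma finite_pred_tree_subset:
  assumes "U \<subseteq> T"
  shows "finite_pred_tree U lt"
proof
  fix t assume "t \<in> U"
  moreover have "preds U lt t \<subseteq> preds T lt t" using assms by (auto simp: preds_def)
  ultimately show "finite (preds U lt t)" using finite_preds assms by (meson finite_subset subsetD)
qed (use assms irrefl trans linear_preds in \<open>(meson subsetD)+\<close>)

text \<open>
  Let \<open>U\<close> be the part of \<open>T\<close> on and above an infinite node. Outside \<open>U\<close> only the common
  predecessors of the node are comparable with elements of \<open>U\<close>, and these lie below all of \<open>U\<close>; so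
  every condensation of \<open>U\<close> extends by the identity. Sending one element \<open>t\<close> of the node to a
  larger one cannot give an automorphism, as the element that is sent to \<open>t\<close> would have to lie in
  \<open>U\<close> below \<open>t\<close>.
\<close>
lemma not_reversible_if_infinite_node:
  assumes count: "countable T" and up: "\<And>y. y \<in> T \<Longrightarrow> infinite {z \<in> T. lt y z}"
    and inf: "infinite {t \<in> T. preds T lt t = P}"
  shows "\<not> reversible T lt"
proof
  assume rev: "reversible T lt"
  define N where "N = {t \<in> T. preds T lt t = P}"
  define U where "U = {s \<in> T. \<exists>t\<in>N. s = t \<or> lt t s}"
  have UT: "U \<subseteq> T" and NU: "N \<subseteq> U" by (auto simp: U_def N_def)
  have U_up: "z \<in> U" if yz: "y \<in> U" "z \<in> T" "lt y z" for y z
  proof -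
    obtain t where t: "t \<in> N" "y = t \<or> lt t y" "y \<in> T" using yz unfolding U_def by blast
    then have "lt t z" using trans[of t y z] yz by (auto simp: N_def)
    then show ?thesis using t yz by (auto simp: U_def)
  qed
  have below_U: "lt s y" if yz: "s \<in> P" "y \<in> U" for s y
  proof -
    obtain t where t: "t \<in> T" "preds T lt t = P" "y = t \<or> lt t y" "y \<in> T"
      using yz unfolding U_def N_def by blast
    then have "s \<in> T" "lt s t" using yz by (auto simp: preds_def)
    then show ?thesis using trans[of s t y] t by blast
  qed
  have outside: "s \<in> P" if s: "s \<in> T" "s \<notin> U" and y: "y \<in> U" "lt s y" for s y
  proof -
    obtain t where t: "t \<in> N" "y = t \<or> lt t y" using y by (auto simp: U_def)
    have tT: "t \<in> T" "y \<in> T" using t y by (auto simp: N_def U_def)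
    have "s \<noteq> t" "\<not> lt t s" using s t by (auto simp: U_def)
    then have "lt s t" using linear_preds[of y s t] t tT s y by blast
    then show ?thesis using t s by (auto simp: N_def preds_def)
  qed
  have min_N: "preds U lt t = {}" if t: "t \<in> N" for t
  proof (rule ccontr)
    assume "preds U lt t \<noteq> {}"
    then obtain s where s: "s \<in> U" "lt s t" by (auto simp: preds_def)
    then have "s \<in> P" using t UT by (auto simp: N_def preds_def)
    then have "lt s s" using below_U s by blast
    then show False using irrefl s UT by blast
  qed
  interpret U: finite_pred_tree U lt by (rule finite_pred_tree_subset[OF UT])
  have infU: "infinite {x \<in> U. preds U lt x = {}}"
  proof
    assume "finite {x \<in> U. preds U lt x = {}}"
    moreover have "N \<subseteq> {x \<in> U. preds U lt x = {}}" using min_N NU by auto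
    ultimately have "finite N" by (rule finite_subset[rotated])
    then show False using inf by (simp add: N_def)
  qed
  have upU: "infinite {z \<in> U. lt y z}" if "y \<in> U" for y
  proof -
    have "{z \<in> U. lt y z} = {z \<in> T. lt y z}" using U_up that UT by blast
    then show ?thesis using up that UT by auto
  qed
  obtain t where t: "t \<in> N" using inf infinite_imp_nonempty unfolding N_def by blast
  then have tU: "t \<in> U" using NU by blast
  obtain y where y: "y \<in> U" "lt t y"
    using upU[OF tU] infinite_imp_nonempty by blast
  obtain g where g: "condensation U lt g" "g t = y"
    using U.condensation_with_prescribed_value[OF countable_subset[OF UT count] infU upU tU min_N[OF t] y(1)]
    by blast
  define f where "f x = (if x \<in> U then g x else x)" for x
  have gbij: "bij_betw g U U"
    and gmono: "\<And>a b. a \<in> U \<Longrightarrow> b \<in> U \<Longrightarrow> lt a b \<Longrightarrow> lt (g a) (g b)"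
    using g by (auto simp: condensation_def monotone_on_def)
  have gU: "g a \<in> U" if "a \<in> U" for a using gbij that by (auto simp: bij_betw_def)
  have "bij_betw f (U \<union> (T - U)) (U \<union> (T - U))"
  proof (rule bij_betw_combine)
    show "bij_betw f U U" using gbij by (simp add: f_def cong: bij_betw_cong)
    have "bij_betw id (T - U) (T - U)" by simp
    then show "bij_betw f (T - U) (T - U)" by (rule bij_betw_cong[THEN iffD1, rotated]) (simp add: f_def)
  qed blast
  then have fbij: "bij_betw f T T" using UT by (simp add: Un_absorb1)
  have "monotone_on T lt lt f"
  proof (rule monotone_onI)
    fix a b assume ab: "a \<in> T" "b \<in> T" "lt a b"
    show "lt (f a) (f b)"
    proof (cases "a \<in> U")
      case True
      then show ?thesis using U_up ab gmono by (simp add: f_def)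
    next
      case False
      then show ?thesis using ab outside[of a b] below_U gU by (auto simp: f_def)
    qed
  qed
  then have iso: "order_iso T lt T lt f"
    using rev fbij by (auto simp: reversible_def condensation_def)
  obtain z where z: "z \<in> U" "g z = t" using gbij tU by (metis bij_betw_imp_surj_on imageE)
  then have "lt (f z) (f t)" using y g tU by (simp add: f_def)
  then have "lt z t" using iso z tU UT unfolding order_iso_def by blast
  then have "z \<in> preds U lt t" using z by (simp add: preds_def)
  then show False using min_N[OF t] by blast
qed

end

section \<open>Trees of finite sequences\<close>

lemma openin_baire_space_finite_dependence:
  "openin baire_space {x. Q (map x [0..<n])}"
proof -
  define C where "C y = (\<Pi>\<^sub>E i\<in>(UNIV::nat set). if i < n then {y i :: nat} else UNIV)" for y
  have "openin baire_space (C y)" for y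
    unfolding C_def baire_space_def
    by (rule product_topology_basis) (auto intro: finite_subset[of _ "{..<n}"])
  moreover have "{x. Q (map x [0..<n])} = (\<Union>y\<in>{x. Q (map x [0..<n])}. C y)"
  proof (intro equalityI subsetI)
    fix x assume "x \<in> (\<Union>y\<in>{x. Q (map x [0..<n])}. C y)"
    then obtain y where y: "Q (map y [0..<n])" "x \<in> C y" by auto
    have "x i = y i" if "i < n" for i
      using PiE_mem[OF y(2)[unfolded C_def] UNIV_I, of i] that by simp
    then have "map x [0..<n] = map y [0..<n]" by (simp cong: map_cong)
    then show "x \<in> {x. Q (map x [0..<n])}" using y(1) by (simp only: mem_Collect_eq)
  qed (auto simp: C_def)
  ultimately show ?thesis by (metis (no_types, lifting) imageE openin_Union)
qed

lemma closedin_infinite_branches: "closedin baire_space (infinite_branches S)"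
proof -
  have top: "topspace baire_space = UNIV" by (simp add: baire_space_def)
  have "topspace baire_space - infinite_branches S = (\<Union>n. {x. map x [0..<n] \<notin> S})"
    by (auto simp: infinite_branches_def top)
  moreover have "openin baire_space (\<Union>n. {x. map x [0..<n] \<notin> S})"
    using openin_baire_space_finite_dependence[of "\<lambda>w. w \<notin> S"] by blast
  ultimately show ?thesis by (simp add: closedin_def top)
qed

lemma infinite_branch_extends:
  assumes closed: "downwards_closed S" and pruned: "\<And>s. s \<in> S \<Longrightarrow> \<exists>n. s @ [n] \<in> S" and s: "s \<in> S"
  obtains x where "x \<in> infinite_branches S" "map x [0..<length s] = s"
proof -
  have "\<exists>v. v 0 = s \<and> (\<forall>k. v k \<in> S \<and> (\<exists>n. v (Suc k) = v k @ [n]))"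
    using dependent_nat_choice[of "\<lambda>k w. w \<in> S \<and> (k = 0 \<longrightarrow> w = s)" "\<lambda>k w w'. \<exists>n. w' = w @ [n]"]
      pruned s by (metis nat.distinct(1))
  then obtain v where v: "v 0 = s" "\<And>k. v k \<in> S" "\<And>k. \<exists>n. v (Suc k) = v k @ [n]" by blast
  have len: "length (v k) = length s + k" for k
  proof (induction k)
    case (Suc k)
    then show ?case using v(3)[of k] by auto
  qed (simp add: v)
  have pre: "prefix (v k) (v l)" if "k \<le> l" for k l
    using that
  proof (induction l rule: dec_induct)
    case (step l)
    then show ?case using v(3)[of l] by auto
  qed simp
  define x where "x i = v (Suc i) ! i" for i
  have nth: "v k ! i = x i" if "i < length (v k)" for k i
  proof -
    have "v k ! i = v (max k (Suc i)) ! i"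
      using pre[of k "max k (Suc i)"] that by (auto simp: prefix_def nth_append)
    moreover have "v (Suc i) ! i = v (max k (Suc i)) ! i"
      using pre[of "Suc i" "max k (Suc i)"] len[of "Suc i"] by (auto simp: prefix_def nth_append)
    ultimately have "v k ! i = v (Suc i) ! i" by simp
    then show ?thesis by (simp add: x_def)
  qed
  have map_x: "map x [0..<n] = take n (v k)" if "n \<le> length (v k)" for n k
    using that nth by (intro nth_equalityI) auto
  have "map x [0..<n] \<in> S" for n
    using map_x[of n n] len v(2)[of n] closed take_is_prefix[of n "v n"]
    unfolding downwards_closed_def by (metis le_add2)
  moreover have "map x [0..<length s] = s" using map_x[of "length s" 0] v(1) by simp
  ultimately show thesis using that unfolding infinite_branches_def by blast
qed

lemma finite_levels_if_finitely_branching: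
  assumes closed: "downwards_closed S" and fin: "\<And>v. finite {n. v @ [n] \<in> S}"
  shows "finite {s \<in> S. length s = k}"
proof (induction k)
  case (Suc k)
  have "{s \<in> S. length s = Suc k} \<subseteq>
    (\<Union>v\<in>{s \<in> S. length s = k}. (\<lambda>n. v @ [n]) ` {n. v @ [n] \<in> S})"
  proof
    fix s assume s: "s \<in> {s \<in> S. length s = Suc k}"
    then have eq: "butlast s @ [last s] = s" by (intro append_butlast_last_id) auto
    moreover have "butlast s \<in> S"
      using closed s prefixeq_butlast unfolding downwards_closed_def by blast
    ultimately show "s \<in> (\<Union>v\<in>{s \<in> S. length s = k}. (\<lambda>n. v @ [n]) ` {n. v @ [n] \<in> S})"
      using s by (intro UN_I[of "butlast s"]) (auto intro!: image_eqI[of _ _ "last s"])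
  qed
  then show ?case by (rule finite_subset) (use Suc fin in blast)
qed simp

text \<open>
  If \<open>S\<close> branches finitely, \<open>[S]\<close> is closed in a product of finite sets. Conversely, each
  coordinate takes only finitely many values on a compact set; pruning is what lets every
  immediate successor \<open>v @ [n]\<close> of \<open>v\<close> in \<open>S\<close> contribute its entry \<open>n\<close> to the values at coordinate
  \<open>length v\<close>.
\<close>
lemma compactin_infinite_branches_iff:
  assumes closed: "downwards_closed S" and pruned: "\<And>s. s \<in> S \<Longrightarrow> \<exists>n. s @ [n] \<in> S"
  shows "compactin baire_space (infinite_branches S) \<longleftrightarrow> (\<forall>v. finite {n. v @ [n] \<in> S})"
proof
  assume comp: "compactin baire_space (infinite_branches S)"
  show "\<forall>v. finite {n. v @ [n] \<in> S}"
  proof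
    fix v :: "nat list"
    have "continuous_map baire_space (discrete_topology UNIV) (\<lambda>x. x (length v))"
      unfolding baire_space_def by (rule continuous_map_product_projection) simp
    then have "compactin (discrete_topology UNIV) ((\<lambda>x. x (length v)) ` infinite_branches S)"
      using comp image_compactin by blast
    then have "finite ((\<lambda>x. x (length v)) ` infinite_branches S)"
      by (simp add: compactin_discrete_topology)
    moreover have "{n. v @ [n] \<in> S} \<subseteq> (\<lambda>x. x (length v)) ` infinite_branches S"
    proof
      fix n assume "n \<in> {n. v @ [n] \<in> S}"
      then obtain x where x: "x \<in> infinite_branches S" "map x [0..<length (v @ [n])] = v @ [n]"
        using infinite_branch_extends[OF closed pruned, of "v @ [n]"] by auto
      have "map x [0..<length (v @ [n])] ! length v = (v @ [n]) ! length v"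
        using x(2) by (rule arg_cong)
      then have "x (length v) = n" by (simp del: upt_Suc)
      then show "n \<in> (\<lambda>x. x (length v)) ` infinite_branches S" using x by blast
    qed
    ultimately show "finite {n. v @ [n] \<in> S}" by (rule finite_subset[rotated])
  qed
next
  assume fin: "\<forall>v. finite {n. v @ [n] \<in> S}"
  define K where "K i = last ` {s \<in> S. length s = Suc i}" for i
  have "finite (K i)" for i
    unfolding K_def using finite_levels_if_finitely_branching[OF closed] fin by blast
  then have "compactin baire_space (\<Pi>\<^sub>E i\<in>UNIV. K i)"
    by (simp add: baire_space_def compactin_PiE compactin_discrete_topology)
  moreover have "infinite_branches S \<subseteq> (\<Pi>\<^sub>E i\<in>UNIV. K i)"
  proof
    fix x assume x: "x \<in> infinite_branches S"
    have "x i \<in> K i" for i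
      unfolding K_def
    proof (rule image_eqI)
      show "x i = last (map x [0..<Suc i])" by simp
      show "map x [0..<Suc i] \<in> {s \<in> S. length s = Suc i}"
        using x by (simp add: infinite_branches_def del: upt_Suc)
    qed
    then show "x \<in> (\<Pi>\<^sub>E i\<in>UNIV. K i)" by (simp add: PiE_iff)
  qed
  ultimately show "compactin baire_space (infinite_branches S)"
    using closed_compactin closedin_infinite_branches by blast
qed

text \<open>
  Outside the root, siblings are the sequences that differ in the last entry only; this is not
  disturbed by removing the empty sequence.
\<close>
lemma preds_strict_prefix_eq_iff:
  assumes closed: "downwards_closed S" and SS': "S - {[]} \<subseteq> S'" "S' \<subseteq> S"
    and w: "w \<in> S'" "w \<noteq> []" "w' \<in> S'" "w' \<noteq> []"
  shows "preds S' strict_prefix w = preds S' strict_prefix w' \<longleftrightarrow> butlast w = butlast w'"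
proof -
  have below: "strict_prefix u z \<longleftrightarrow> prefix u (butlast z)" if "z \<noteq> []" for u z :: "nat list"
    using that by (metis append_butlast_last_id not_Cons_self2 append_self_conv prefix_order.less_le
        prefix_snoc prefix_order.dual_order.strict_iff_order prefix_order.less_le_not_le prefixI)
  have "prefix (butlast a) (butlast b)"
    if "preds S' strict_prefix a = preds S' strict_prefix b" "a \<in> S'" "a \<noteq> []" "b \<noteq> []" for a b
  proof (cases "butlast a = []")
    case False
    have "butlast a \<in> S"
      using that closed SS' prefixeq_butlast unfolding downwards_closed_def by blast
    then have "butlast a \<in> preds S' strict_prefix a"
      using False SS' below that by (auto simp: preds_def)
    then show ?thesis using that below by (auto simp: preds_def)
  qed simp
  then have "butlast w = butlast w'" if "preds S' strict_prefix w = preds S' strict_prefix w'"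
    using that w by (simp add: prefix_order.antisym)
  moreover have "preds S' strict_prefix w = preds S' strict_prefix w'" if "butlast w = butlast w'"
    using that w below by (auto simp: preds_def)
  ultimately show ?thesis by blast
qed

lemma order_iso_preds:
  assumes iso: "order_iso T lt S lt' f" and t: "t \<in> T"
  shows "f ` preds T lt t = preds S lt' (f t)"
  using assms unfolding order_iso_def preds_def bij_betw_def by blast

lemma order_iso_preds_eq_iff:
  assumes iso: "order_iso T lt S lt' f" and "t \<in> T" "u \<in> T"
  shows "preds T lt t = preds T lt u \<longleftrightarrow> preds S lt' (f t) = preds S lt' (f u)"
proof -
  have "inj_on f T" using iso by (simp add: order_iso_def bij_betw_def)
  moreover have "preds T lt t \<subseteq> T" "preds T lt u \<subseteq> T" by (auto simp: preds_def)
  ultimately have "f ` preds T lt t = f ` preds T lt u \<longleftrightarrow> preds T lt t = preds T lt u"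
    by (rule inj_on_image_eq_iff)
  then show ?thesis using order_iso_preds[OF iso] assms by simp
qed

text \<open>
  The isomorphism matches each node, except possibly the one made up of the root alone, with the
  set of all immediate successors of some sequence \<open>v\<close> in \<open>S\<close>.
\<close>
lemma (in finite_pred_tree) finite_nodes_iff_finitely_branching:
  assumes iso: "order_iso T lt S' strict_prefix f" and closed: "downwards_closed S"
    and SS': "S - {[]} \<subseteq> S'" "S' \<subseteq> S"
  shows "(\<forall>N\<in>nodes T lt. finite N) \<longleftrightarrow> (\<forall>v. finite {n. v @ [n] \<in> S})"
  unfolding finite_nodes_iff
proof
  have bij: "bij_betw f T S'" using iso by (simp add: order_iso_def)
  have fS': "f t \<in> S'" if "t \<in> T" for t using bij that by (auto simp: bij_betw_def)
  have siblings: "preds T lt t = preds T lt u \<longleftrightarrow> butlast (f t) = butlast (f u)"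
    if "t \<in> T" "u \<in> T" "f t \<noteq> []" "f u \<noteq> []" for t u
    using order_iso_preds_eq_iff[OF iso] preds_strict_prefix_eq_iff[OF closed SS'] that fS' by simp
  {
    assume fin: "\<forall>P. finite {t \<in> T. preds T lt t = P}"
    show "\<forall>v. finite {n. v @ [n] \<in> S}"
    proof
      fix v :: "nat list"
      show "finite {n. v @ [n] \<in> S}"
      proof (cases "{n. v @ [n] \<in> S} = {}")
        case False
        have preimage: "\<exists>t\<in>T. f t = v @ [n]" if "v @ [n] \<in> S" for n
        proof -
          have "v @ [n] \<in> S'" using that SS' by blast
          then show ?thesis using bij by (metis bij_betw_imp_surj_on imageE)
        qed
        obtain n0 where "v @ [n0] \<in> S" using False by blast
        then obtain t0 where t0: "t0 \<in> T" "f t0 = v @ [n0]" using preimage by blast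
        have "{n. v @ [n] \<in> S} \<subseteq> (\<lambda>t. last (f t)) ` {t \<in> T. preds T lt t = preds T lt t0}"
        proof
          fix n assume "n \<in> {n. v @ [n] \<in> S}"
          then obtain t where t: "t \<in> T" "f t = v @ [n]" using preimage by blast
          then show "n \<in> (\<lambda>t. last (f t)) ` {t \<in> T. preds T lt t = preds T lt t0}"
            using siblings[of t t0] t0 by (intro image_eqI[of _ _ t]) auto
        qed
        then show ?thesis by (rule finite_subset) (use fin in blast)
      next
        case True
        then show ?thesis by (metis finite.emptyI)
      qed
    qed
  next
    assume fin: "\<forall>v. finite {n. v @ [n] \<in> S}"
    show "\<forall>P. finite {t \<in> T. preds T lt t = P}"
    proof
      fix P
      define M where "M = {t \<in> T. preds T lt t = P}"
      have "finite (f ` M)"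
      proof (cases "\<exists>t0\<in>M. f t0 \<noteq> []")
        case True
        then obtain t0 where t0: "t0 \<in> M" "f t0 \<noteq> []" by blast
        define v where "v = butlast (f t0)"
        have "f ` M \<subseteq> insert [] ((\<lambda>n. v @ [n]) ` {n. v @ [n] \<in> S})"
        proof
          fix w assume "w \<in> f ` M"
          then obtain t where t: "t \<in> M" "w = f t" by blast
          show "w \<in> insert [] ((\<lambda>n. v @ [n]) ` {n. v @ [n] \<in> S})"
          proof (cases "w = []")
            case False
            then have "butlast w = v"
              using siblings[of t t0] t t0 by (simp add: M_def v_def)
            then have "v @ [last w] = w" using False by (metis append_butlast_last_id)
            moreover have "w \<in> S" using t fS' SS' by (auto simp: M_def)
            ultimately show ?thesis by (auto intro!: image_eqI[of _ _ "last w"])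
          qed simp
        qed
        then show ?thesis by (rule finite_subset) (use fin in blast)
      next
        case False
        then have "f ` M \<subseteq> {[]}" by blast
        then show ?thesis by (rule finite_subset) simp
      qed
      moreover have "inj_on f M" using bij by (auto simp: bij_betw_def inj_on_def M_def)
      ultimately show "finite {t \<in> T. preds T lt t = P}"
        unfolding M_def by (rule finite_imageD)
    qed
  }
qed

lemma pruned_if_no_maximal_elements:
  assumes iso: "order_iso T lt S' strict_prefix f" and closed: "downwards_closed S"
    and SS': "S - {[]} \<subseteq> S'" "S' \<subseteq> S"
    and T: "T \<noteq> {}" and up: "\<And>t. t \<in> T \<Longrightarrow> \<exists>u\<in>T. lt t u" and s: "s \<in> S"
  shows "\<exists>n. s @ [n] \<in> S"
proof -
  have bij: "f ` T = S'" using iso by (simp add: order_iso_def bij_betw_def)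
  have "\<exists>w\<in>S'. strict_prefix s w"
  proof (cases "s \<in> S'")
    case True
    then obtain t where t: "t \<in> T" "f t = s" using bij by blast
    then obtain u where u: "u \<in> T" "lt t u" using up by blast
    then have "strict_prefix s (f u)" using iso t by (auto simp: order_iso_def)
    then show ?thesis using u bij by blast
  next
    case False
    then have "s = []" using s SS' by blast
    moreover obtain w where "w \<in> S'" using T bij by blast
    ultimately show ?thesis using False by (metis strict_prefix_simps(2) neq_Nil_conv)
  qed
  then obtain w where w: "w \<in> S" "strict_prefix s w" using SS' by blast
  then obtain n z where "w = s @ n # z" by (auto elim: strict_prefixE')
  then have "prefix (s @ [n]) w" by (simp add: prefix_def)
  then show ?thesis using w closed unfolding downwards_closed_def by blast
qed

text \<open>
  Number the elements of the tree and send \<open>t\<close> to the list of the numbers of its ancestors, \<open>t\<close>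
  itself being the last of them.
\<close>
lemma (in finite_pred_tree) embeds_into_sequences:
  assumes "countable T"
  obtains f :: "'a \<Rightarrow> nat list"
  where "order_iso T lt (f ` T) strict_prefix f" "downwards_closed (insert [] (f ` T))"
    "\<And>t. t \<in> T \<Longrightarrow> length (f t) = Suc (height t)"
proof -
  obtain e :: "'a \<Rightarrow> nat" where e: "inj_on e T" using assms by (auto simp: countable_def)
  define anc where "anc t k = (SOME s. s \<in> T \<and> (s = t \<or> lt s t) \<and> height s = k)" for t k
  have anc: "anc t k \<in> T" "anc t k = t \<or> lt (anc t k) t" "height (anc t k) = k"
    if "t \<in> T" "k \<le> height t" for t k
    using someI_ex[of "\<lambda>s. s \<in> T \<and> (s = t \<or> lt s t) \<and> height s = k"] ancestor_exists[OF that]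
    unfolding anc_def by blast+
  have anc_self: "anc t (height t) = t" if "t \<in> T" for t
    using anc[OF that order_refl] height_less that by (metis nat_less_le)
  have anc_anc: "anc s k = anc t k" if st: "s \<in> T" "t \<in> T" "s = t \<or> lt s t" "k \<le> height s" for s t k
  proof -
    have k: "k \<le> height t" using st height_less[of s t] by auto
    have "anc s k = t \<or> lt (anc s k) t"
      using anc[of s k] st trans[of "anc s k" s t] by metis
    then show ?thesis
      using ancestor_unique[of t "anc s k" "anc t k"] anc[of s k] anc[of t k] st k by simp
  qed
  define f where "f t = map (\<lambda>k. e (anc t k)) [0..<Suc (height t)]" for t
  have len: "length (f t) = Suc (height t)" for t by (simp add: f_def)
  have nth: "f t ! k = e (anc t k)" if "k \<le> height t" for t k
    using that by (simp add: f_def del: upt_Suc)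
  have take_f: "take (Suc (height s)) (f t) = f s" if "s \<in> T" "t \<in> T" "s = t \<or> lt s t" for s t
  proof (rule nth_equalityI)
    have "height s \<le> height t" using that height_less[of s t] by auto
    then show "length (take (Suc (height s)) (f t)) = length (f s)" by (simp add: len)
    fix i assume "i < length (take (Suc (height s)) (f t))"
    then show "take (Suc (height s)) (f t) ! i = f s ! i"
      using anc_anc[OF that] nth len by simp
  qed
  have prefix_iff: "prefix (f s) (f t) \<longleftrightarrow> s = t \<or> lt s t" if st: "s \<in> T" "t \<in> T" for s t
  proof
    assume p: "prefix (f s) (f t)"
    then have le: "height s \<le> height t" using prefix_length_le[OF p] by (simp add: len)
    have "f s ! height s = f t ! height s"
      using p len by (auto simp: prefix_def nth_append)
    then have "e s = e (anc t (height s))" using nth le anc_self st by simp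
    then have "s = anc t (height s)"
      using e st anc(1)[OF st(2) le] by (auto simp: inj_on_def)
    then show "s = t \<or> lt s t" using anc(2)[OF st(2) le] by simp
  next
    assume "s = t \<or> lt s t"
    then show "prefix (f s) (f t)" using take_f[OF st] take_is_prefix by metis
  qed
  have inj: "inj_on f T"
  proof (rule inj_onI)
    fix s t assume st: "s \<in> T" "t \<in> T" "f s = f t"
    then have "s = t \<or> lt s t" using prefix_iff[OF st(1,2)] by simp
    moreover have "height s = height t" using st len by (metis nat.inject)
    ultimately show "s = t" using height_less[of s t] st by auto
  qed
  have iso: "order_iso T lt (f ` T) strict_prefix f"
    unfolding order_iso_def
  proof (intro conjI ballI)
    show "bij_betw f T (f ` T)" using inj by (simp add: bij_betw_def)
    fix s t assume st: "s \<in> T" "t \<in> T"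
    have "f s = f t \<longleftrightarrow> s = t" using inj st by (auto simp: inj_on_def)
    then show "lt s t \<longleftrightarrow> strict_prefix (f s) (f t)"
      using prefix_iff[OF st] irrefl st unfolding strict_prefix_def by metis
  qed
  have "downwards_closed (insert [] (f ` T))"
    unfolding downwards_closed_def
  proof (intro ballI allI impI)
    fix w u assume w: "w \<in> insert [] (f ` T)" and u: "prefix u w"
    show "u \<in> insert [] (f ` T)"
    proof (cases "u = []")
      case False
      then obtain t where t: "t \<in> T" "w = f t" using w u by auto
      obtain k where k: "length u = Suc k" using False by (cases u) auto
      have kt: "k \<le> height t" using prefix_length_le[OF u] t k len by simp
      have "u = take (Suc k) (f t)" using u t k by (auto simp: prefix_def)
      also have "\<dots> = f (anc t k)" using take_f[of "anc t k" t] anc[OF t(1) kt] t by simp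
      finally show ?thesis using anc[OF t(1) kt] by blast
    qed simp
  qed
  then show thesis using that iso len by blast
qed

text \<open>
  In the rooted case all sequences given by \<open>embeds_into_sequences\<close> start with the number of the root, and
  dropping this entry makes the root the empty sequence.
\<close>
lemma (in finite_pred_tree) representation_exists:
  assumes "countable T"
  shows "\<exists>S. represents T lt S"
proof -
  obtain f :: "'a \<Rightarrow> nat list" where iso: "order_iso T lt (f ` T) strict_prefix f"
    and closed: "downwards_closed (insert [] (f ` T))"
    and len: "\<And>t. t \<in> T \<Longrightarrow> length (f t) = Suc (height t)"
    using embeds_into_sequences[OF assms] by blast
  have ne: "f t \<noteq> []" if "t \<in> T" for t using len[OF that] by auto
  show ?thesis
  proof (cases "\<exists>r\<in>T. \<forall>t\<in>T. t = r \<or> lt r t")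
    case False
    have "insert [] (f ` T) - {[]} = f ` T" using ne by fastforce
    then have "represents T lt (insert [] (f ` T))"
      using False iso closed unfolding represents_def by auto
    then show ?thesis by blast
  next
    case True
    then obtain r where r: "r \<in> T" "\<And>t. t \<in> T \<Longrightarrow> t = r \<or> lt r t" by blast
    have "preds T lt r = {}"
    proof (rule ccontr)
      assume "preds T lt r \<noteq> {}"
      then obtain s where "s \<in> T" "lt s r" by (auto simp: preds_def)
      then show False using r(1) r(2)[of s] irrefl trans[of r s r] by blast
    qed
    then have "length (f r) = 1" using len[OF r(1)] by (simp add: height_def)
    then obtain a where a: "f r = [a]" by (auto simp: length_Suc_conv)
    have fr: "prefix (f r) (f t)" if "t \<in> T" for t
      using iso r(1) r(2)[OF that] that unfolding order_iso_def strict_prefix_def by blast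
    have split: "f t = a # tl (f t)" if "t \<in> T" for t
      using fr[OF that] a by (cases "f t") auto
    define g where "g t = tl (f t)" for t
    have fg: "f t = a # g t" if "t \<in> T" for t using split[OF that] by (simp add: g_def)
    have "order_iso T lt (g ` T) strict_prefix g"
      unfolding order_iso_def
    proof (intro conjI ballI)
      have "inj_on f T" using iso by (simp add: order_iso_def bij_betw_def)
      then have "inj_on g T" using fg by (auto simp: inj_on_def)
      then show "bij_betw g T (g ` T)" by (simp add: bij_betw_def)
      fix s t assume "s \<in> T" "t \<in> T"
      then show "lt s t \<longleftrightarrow> strict_prefix (g s) (g t)"
        using iso fg unfolding order_iso_def by auto
    qed
    moreover have "downwards_closed (g ` T)"
      unfolding downwards_closed_def
    proof (intro ballI allI impI)
      fix w u assume "w \<in> g ` T" and u: "prefix u w"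
      then obtain t where t: "t \<in> T" "w = g t" by blast
      then have "prefix (a # u) (f t)" using fg u by simp
      then have "a # u \<in> insert [] (f ` T)"
        using closed t unfolding downwards_closed_def by blast
      then obtain s where s: "s \<in> T" "a # u = f s" by blast
      then have "u = g s" using fg[of s] by simp
      then show "u \<in> g ` T" using s by blast
    qed
    ultimately have "represents T lt (g ` T)" using True unfolding represents_def by auto
    then show ?thesis by blast
  qed
qed

lemma (in finite_pred_tree) finite_nodes_iff_compact:
  assumes rep: "represents T lt S" and T: "T \<noteq> {}" and up: "\<And>t. t \<in> T \<Longrightarrow> \<exists>u\<in>T. lt t u"
  shows "(\<forall>N\<in>nodes T lt. finite N) \<longleftrightarrow> compactin baire_space (infinite_branches S)"
proof -
  have closed: "downwards_closed S" using rep by (simp add: represents_def)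
  obtain S' f where iso: "order_iso T lt S' strict_prefix f" and SS': "S - {[]} \<subseteq> S'" "S' \<subseteq> S"
    using rep unfolding represents_def by (metis Diff_subset order_refl)
  show ?thesis
    using finite_nodes_iff_finitely_branching[OF iso closed SS']
      compactin_infinite_branches_iff[OF closed pruned_if_no_maximal_elements[OF iso closed SS' T up]]
    by simp
qed

section \<open>Reversibility of trees of height at most \<open>\<omega>\<close>\<close>

theorem theorem3p4:
  fixes T :: "'a set" and lt :: "'a \<Rightarrow> 'a \<Rightarrow> bool"
  assumes "is_tree T lt"
    and "\<And>B. branch T lt B \<Longrightarrow> order_on lt B =o tree_height T lt"
  shows "(tree_height T lt <o natLeq \<longrightarrow> reversible T lt) \<and>
    (tree_height T lt =o natLeq \<and> |T| =o natLeq \<longrightarrow>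
       (reversible T lt \<longleftrightarrow> (\<forall>N\<in>nodes T lt. finite N)) \<and>
       (\<exists>S. represents T lt S) \<and>
       (\<forall>S. represents T lt S \<longrightarrow>
          ((\<forall>N\<in>nodes T lt. finite N) \<longleftrightarrow> compactin baire_space (infinite_branches S))))"
proof -
  interpret linear_pred_tree T lt using assms(1) by (rule is_tree_linear_preds)
  note type = assms(2)
  have preds_in_branch: "\<exists>B. branch T lt B \<and> t \<in> B \<and> preds T lt t = {x \<in> B. lt x t}" if t: "t \<in> T" for t
  proof -
    obtain B where B: "branch T lt B" "t \<in> B" using t by (rule branch_through)
    then have "preds T lt t = {x \<in> B. lt x t}"
      using preds_subset_branch[OF B] branch_subset[OF B(1)] unfolding preds_def by blast
    then show ?thesis using B by blast
  qed
  have "reversible T lt" if finite_height: "tree_height T lt <o natLeq"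
  proof -
    have fin: "finite B" if "branch T lt B" for B
      using type[OF that] finite_height by (rule finite_if_order_type_finite)
    interpret finite_pred_tree T lt
    proof
      fix t assume "t \<in> T"
      then obtain B where "branch T lt B" "preds T lt t = {x \<in> B. lt x t}"
        using preds_in_branch by blast
      then show "finite (preds T lt t)" using fin by simp
    qed
    obtain B0 where B0: "branch T lt B0" using pred_on.Hausdorff by blast
    show ?thesis
    proof (rule reversible_if_branches_equally_finite)
      show "finite B" if "branch T lt B" for B using that by (rule fin)
      show "card B = card B0" if "branch T lt B" for B
        using type[OF that] type[OF B0] by (rule card_eq_if_order_types_eq)
    qed
  qed
  moreover have "(reversible T lt \<longleftrightarrow> (\<forall>N\<in>nodes T lt. finite N)) \<and>
       (\<exists>S. represents T lt S) \<and>
       (\<forall>S. represents T lt S \<longrightarrow>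
          ((\<forall>N\<in>nodes T lt. finite N) \<longleftrightarrow> compactin baire_space (infinite_branches S)))"
    if omega: "tree_height T lt =o natLeq" and card: "|T| =o natLeq"
  proof -
    have type_omega: "order_on lt B =o natLeq" if "branch T lt B" for B
      using type[OF that] omega by (rule ordIso_transitive)
    interpret finite_pred_tree T lt
    proof
      fix t assume "t \<in> T"
      then obtain B where "branch T lt B" "t \<in> B" "preds T lt t = {x \<in> B. lt x t}"
        using preds_in_branch by blast
      then show "finite (preds T lt t)" using order_type_omega(2)[OF type_omega] by simp
    qed
    have count: "countable T"
      using card by (simp add: countable_card_le_natLeq ordIso_imp_ordLeq)
    have up: "infinite {z \<in> T. lt y z}" if y: "y \<in> T" for y
    proof -
      obtain B where B: "branch T lt B" "y \<in> B" using y by (rule branch_through)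
      then have "B \<subseteq> insert y (preds T lt y) \<union> {z \<in> T. lt y z}"
        by (auto simp: pred_on.maxchain_def pred_on.chain_def preds_def)
      moreover have "infinite B" using order_type_omega(1) type_omega B by blast
      ultimately show ?thesis
        using finite_preds[OF y] by (meson finite_Un finite_insert finite_subset)
    qed
    obtain B0 where B0: "branch T lt B0" using pred_on.Hausdorff by blast
    have T: "T \<noteq> {}"
      using order_type_omega(1)[OF type_omega[OF B0]] branch_subset[OF B0] by auto
    have above: "\<exists>u\<in>T. lt t u" if "t \<in> T" for t
      using up[OF that] infinite_imp_nonempty by blast
    have "reversible T lt \<longleftrightarrow> (\<forall>N\<in>nodes T lt. finite N)"
      unfolding finite_nodes_iff
      using not_reversible_if_infinite_node[OF count up]
        reversible_if_levels_finite[OF finite_levels_if_finite_nodes] by blast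
    then show ?thesis
      using representation_exists[OF count] finite_nodes_iff_compact[OF _ T above] by blast
  qed
  ultimately show ?thesis by blast
qed

end
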